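(* Let $(M,g,\nabla)$ be a quasi-statistical manifold with dual connection $\nabla^*$, and let $\nabla^{(0)}=\frac12(\nabla+\nabla^* )$. Then for all vector fields $X,Y,Z$ on $M$: (i) $$\begin{aligned}R(X,Y)Z&=R^{(0)}(X,Y)Z-\tfrac12\big\{(\nabla^{(0)}_XK)(Y,Z)-(\nabla^{(0)}_YK)(X,Z)-\tfrac12[K_X,K_Y]Z\big\}-\tfrac12K(T^{(0)}(X,Y),Z)\\&=R^{(0)}(X,Y)Z-\tfrac12\big\{(\nabla_XK)(Y,Z)-(\nabla_YK)(X,Z)+\tfrac12[K_X,K_Y]Z\big\};\end{aligned}$$ (ii) $$\begin{aligned}R^*(X,Y)Z&=R^{(0)}(X,Y)Z+\tfrac12\big\{(\nabla^{(0)}_XK)(Y,Z)-(\nabla^{(0)}_YK)(X,Z)+\tfrac12[K_X,K_Y]Z\big\}+\tfrac12K(T^{(0)}(X,Y),Z)\\&=R^{(0)}(X,Y)Z+\tfrac12\big\{(\nabla_XK)(Y,Z)-(\nabla_YK)(X,Z)+\tfrac32[K_X,K_Y]Z\big\};\end{aligned}$$ (iii) $$\begin{aligned}R(X,Y)Z-R^*(X,Y)Z&=-\big\{(\nabla^{(0)}_XK)(Y,Z)-(\nabla^{(0)}_YK)(X,Z)\big\}-K(T^{(0)}(X,Y),Z)\\&=-\big\{(\nabla_XK)(Y,Z)-(\nabla_YK)(X,Z)+[K_X,K_Y]Z\big\};\end{aligned}$$ (iv) $$R(X,Y)Z+R^*(X,Y)Z=2R^{(0)}(X,Y)Z+\t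frac12[K_X,K_Y]Z.$$
   Context: $(M,g)$ is a (pseudo-)Riemannian manifold and $\nabla$ an affine connection. The $g$-dual connection $\nabla^*$ is determined by $X(g(Y,Z))=g(\nabla_XY,Z)+g(Y,\nabla^*_XZ)$. $(M,g,\nabla)$ is quasi-statistical if $\nabla$ is torsion-free, where the torsion is $T(X,Y)=\nabla_XY-\nabla_YX-[X,Y]$ ($\nabla^*$ may have torsion). The difference tensor is $K_XY=K(X,Y)=\nabla^*_XY-\nabla_XY$, and $[K_X,K_Y]Z=K(X,K(Y,Z))-K(Y,K(X,Z))$. Covariant derivative: $(\nabla_XK)(Y,Z)=\nabla_X(K(Y,Z))-K(\nabla_XY,Z)-K(Y,\nabla_XZ)$ (similarly for $\nabla^{(0)}$). Curvature: $R(X,Y)Z=\nabla_X\nabla_YZ-\nabla_Y\nabla_XZ-\nabla_{[X,Y]}Z$. $R$ belongs to $\nabla$; $R^*$ to $\nabla^*$; $R^{(0)},T^{(0)}$ are the curvature and torsion of $\nabla^{(0)}$. *)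

theory Defs
  imports "HOL-Analysis.Analysis" "HOL-Library.Function_Algebras"
begin

text \<open>
  Together with \<open>Function_Algebras\<close>, the following instance makes tangent vectors (functionals on
  functions) and vector fields real vector spaces under the pointwise operations.
\<close>

instantiation "fun" :: (type, real_vector) real_vector
begin

definition scaleR_fun :: "real \<Rightarrow> ('a \<Rightarrow> 'b) \<Rightarrow> 'a \<Rightarrow> 'b"
  where "scaleR_fun c f = (\<lambda>x. c *\<^sub>R f x)"

instance
  by standard (auto simp: scaleR_fun_def fun_eq_iff scaleR_add_left scaleR_add_right)

end

lemma scaleR_fun_apply [simp]: "(c *\<^sub>R f) x = c *\<^sub>R f x"
  by (simp add: scaleR_fun_def)


section \<open>Smooth manifolds\<close>

text \<open>The derivatives below are taken in the whole space, so the set \<open>S\<close> is meant to be open.\<close>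

primrec Ck_on :: "nat \<Rightarrow> 'a::real_normed_vector set \<Rightarrow> ('a \<Rightarrow> 'b::real_normed_vector) \<Rightarrow> bool" where
  "Ck_on 0 S f \<longleftrightarrow> continuous_on S f"
| "Ck_on (Suc k) S f \<longleftrightarrow>
     (\<forall>x\<in>S. f differentiable (at x)) \<and> (\<forall>v. Ck_on k S (\<lambda>x. frechet_derivative f (at x) v))"

definition smooth_on :: "'a::real_normed_vector set \<Rightarrow> ('a \<Rightarrow> 'b::real_normed_vector) \<Rightarrow> bool"
  where "smooth_on S f \<longleftrightarrow> (\<forall>k. Ck_on k S f)"

text \<open>
  The manifold is a whole type \<open>'m\<close>, Hausdorff and second countable by its sort; a chart is a pair
  of a domain and a coordinate map into the model space \<open>'b\<close>, whose dimension \<open>DIM('b)\<close> is the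
  dimension of the manifold. The atlas need not be maximal.
\<close>

type_synonym ('m, 'b) chart = "'m set \<times> ('m \<Rightarrow> 'b)"

definition smooth_atlas ::
  "('m::{t2_space, second_countable_topology}, 'b::euclidean_space) chart set \<Rightarrow> bool"
  where "smooth_atlas A \<longleftrightarrow>
    (\<Union>(U, \<phi>)\<in>A. U) = UNIV \<and>
    (\<forall>(U, \<phi>)\<in>A. open U \<and> open (\<phi> ` U) \<and> homeomorphism U (\<phi> ` U) \<phi> (inv_into U \<phi>)) \<and>
    (\<forall>(U, \<phi>)\<in>A. \<forall>(V, \<psi>)\<in>A. smooth_on (\<phi> ` (U \<inter> V)) (\<psi> \<circ> inv_into U \<phi>))"

definition smooth_functions ::
  "('m::{t2_space, second_countable_topology}, 'b::euclidean_space) chart set \<Rightarrow> ('m \<Rightarrow> real) set"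
  where "smooth_functions A = {f. \<forall>(U, \<phi>)\<in>A. smooth_on (\<phi> ` U) (f \<circ> inv_into U \<phi>)}"


section \<open>Tangent vectors and vector fields\<close>

text \<open>
  A tangent vector at \<open>p\<close> is a derivation at \<open>p\<close> of the algebra of smooth functions. It is extended
  by \<open>0\<close> to functions that are not smooth, so that equality of tangent vectors is equality on smooth
  functions.
\<close>

type_synonym 'm tvec = "('m \<Rightarrow> real) \<Rightarrow> real"

type_synonym 'm vfield = "'m \<Rightarrow> 'm tvec"

definition tangent_space ::
  "('m::{t2_space, second_countable_topology}, 'b::euclidean_space) chart set \<Rightarrow> 'm \<Rightarrow> 'm tvec set"
  where "tangent_space A p = {v.
    (\<forall>f\<in>smooth_functions A. \<forall>h\<in>smooth_functions A. v (\<lambda>q. f q + h q) = v f + v h) \<and>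
    (\<forall>c. \<forall>f\<in>smooth_functions A. v (\<lambda>q. c * f q) = c * v f) \<and>
    (\<forall>f\<in>smooth_functions A. \<forall>h\<in>smooth_functions A. v (\<lambda>q. f q * h q) = f p * v h + h p * v f) \<and>
    (\<forall>f. f \<notin> smooth_functions A \<longrightarrow> v f = 0)}"

text \<open>\<open>vf_apply X f\<close> is the function \<open>X f\<close>.\<close>

definition vf_apply :: "'m vfield \<Rightarrow> ('m \<Rightarrow> real) \<Rightarrow> 'm \<Rightarrow> real"
  where "vf_apply X f = (\<lambda>p. X p f)"

definition vector_fields ::
  "('m::{t2_space, second_countable_topology}, 'b::euclidean_space) chart set \<Rightarrow> 'm vfield set"
  where "vector_fields A = {X.
    (\<forall>p. X p \<in> tangent_space A p) \<and>
    (\<forall>f\<in>smooth_functions A. vf_apply X f \<in> smooth_functions A)}"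

definition fmult :: "('m \<Rightarrow> real) \<Rightarrow> 'm vfield \<Rightarrow> 'm vfield"
  where "fmult f X = (\<lambda>p. f p *\<^sub>R X p)"

text \<open>
  On a function that is not smooth the bracket of vector fields vanishes, in accordance with the
  convention for tangent vectors, since the zero function is smooth.
\<close>

definition lie_bracket :: "'m vfield \<Rightarrow> 'm vfield \<Rightarrow> 'm vfield"
  where "lie_bracket X Y = (\<lambda>p f. X p (vf_apply Y f) - Y p (vf_apply X f))"


section \<open>Metrics and affine connections\<close>

text \<open>
  A smooth field of nondegenerate symmetric bilinear forms on the tangent spaces, of arbitrary
  signature. Smoothness is tested on vector fields.
\<close>

definition pseudo_riemannian_metric ::
  "('m::{t2_space, second_countable_topology}, 'b::euclidean_space) chart set \<Rightarrow>
   ('m \<Rightarrow> 'm tvec \<Rightarrow> 'm tvec \<Rightarrow> real) \<Rightarrow> bool"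
  where "pseudo_riemannian_metric A g \<longleftrightarrow>
    (\<forall>p. \<forall>u\<in>tangent_space A p. \<forall>v\<in>tangent_space A p. g p u v = g p v u) \<and>
    (\<forall>p. \<forall>u\<in>tangent_space A p. \<forall>v\<in>tangent_space A p. \<forall>w\<in>tangent_space A p.
       g p (u + v) w = g p u w + g p v w) \<and>
    (\<forall>p c. \<forall>u\<in>tangent_space A p. \<forall>v\<in>tangent_space A p. g p (c *\<^sub>R u) v = c * g p u v) \<and>
    (\<forall>p. \<forall>u\<in>tangent_space A p. (\<forall>v\<in>tangent_space A p. g p u v = 0) \<longrightarrow> u = 0) \<and>
    (\<forall>X\<in>vector_fields A. \<forall>Y\<in>vector_fields A. (\<lambda>p. g p (X p) (Y p)) \<in> smooth_functions A)"

type_synonym 'm connection = "'m vfield \<Rightarrow> 'm vfield \<Rightarrow> 'm vfield"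

definition affine_connection ::
  "('m::{t2_space, second_countable_topology}, 'b::euclidean_space) chart set \<Rightarrow>
   'm connection \<Rightarrow> bool"
  where "affine_connection A D \<longleftrightarrow>
    (\<forall>X\<in>vector_fields A. \<forall>Y\<in>vector_fields A. D X Y \<in> vector_fields A) \<and>
    (\<forall>X\<in>vector_fields A. \<forall>Y\<in>vector_fields A. \<forall>Z\<in>vector_fields A. D (X + Y) Z = D X Z + D Y Z) \<and>
    (\<forall>f\<in>smooth_functions A. \<forall>X\<in>vector_fields A. \<forall>Y\<in>vector_fields A.
       D (fmult f X) Y = fmult f (D X Y)) \<and>
    (\<forall>X\<in>vector_fields A. \<forall>Y\<in>vector_fields A. \<forall>Z\<in>vector_fields A. D X (Y + Z) = D X Y + D X Z) \<and>
    (\<forall>f\<in>smooth_functions A. \<forall>X\<in>vector_fields A. \<forall>Y\<in>vector_fields A.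
       D X (fmult f Y) = fmult (vf_apply X f) Y + fmult f (D X Y))"

definition torsion :: "'m connection \<Rightarrow> 'm vfield \<Rightarrow> 'm vfield \<Rightarrow> 'm vfield"
  where "torsion D X Y = D X Y - D Y X - lie_bracket X Y"

definition curvature :: "'m connection \<Rightarrow> 'm vfield \<Rightarrow> 'm vfield \<Rightarrow> 'm vfield \<Rightarrow> 'm vfield"
  where "curvature D X Y Z = D X (D Y Z) - D Y (D X Z) - D (lie_bracket X Y) Z"

definition quasi_statistical_manifold ::
  "('m::{t2_space, second_countable_topology}, 'b::euclidean_space) chart set \<Rightarrow>
   ('m \<Rightarrow> 'm tvec \<Rightarrow> 'm tvec \<Rightarrow> real) \<Rightarrow> 'm connection \<Rightarrow> bool"
  where "quasi_statistical_manifold A g D \<longleftrightarrow>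
    smooth_atlas A \<and> pseudo_riemannian_metric A g \<and> affine_connection A D \<and>
    (\<forall>X\<in>vector_fields A. \<forall>Y\<in>vector_fields A. torsion D X Y = 0)"

definition dual_connection ::
  "('m::{t2_space, second_countable_topology}, 'b::euclidean_space) chart set \<Rightarrow>
   ('m \<Rightarrow> 'm tvec \<Rightarrow> 'm tvec \<Rightarrow> real) \<Rightarrow> 'm connection \<Rightarrow> 'm connection \<Rightarrow> bool"
  where "dual_connection A g D D' \<longleftrightarrow>
    affine_connection A D' \<and>
    (\<forall>X\<in>vector_fields A. \<forall>Y\<in>vector_fields A. \<forall>Z\<in>vector_fields A. \<forall>p.
       X p (\<lambda>q. g q (Y q) (Z q)) = g p (D X Y p) (Z p) + g p (Y p) (D' X Z p))"

definition mean_connection :: "'m connection \<Rightarrow> 'm connection \<Rightarrow> 'm connection"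
  where "mean_connection D D' = (\<lambda>X Y. (1/2) *\<^sub>R (D X Y + D' X Y))"

definition difference_tensor ::
  "'m connection \<Rightarrow> 'm connection \<Rightarrow> 'm vfield \<Rightarrow> 'm vfield \<Rightarrow> 'm vfield"
  where "difference_tensor D D' = (\<lambda>X Y. D' X Y - D X Y)"

text \<open>\<open>cov_deriv D K X Y Z\<close> is \<open>(D\<^sub>X K)(Y, Z)\<close>, and \<open>tensor_comm K X Y Z\<close> is \<open>[K\<^sub>X, K\<^sub>Y] Z\<close>.\<close>

definition cov_deriv ::
  "'m connection \<Rightarrow> ('m vfield \<Rightarrow> 'm vfield \<Rightarrow> 'm vfield) \<Rightarrow>
   'm vfield \<Rightarrow> 'm vfield \<Rightarrow> 'm vfield \<Rightarrow> 'm vfield"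
  where "cov_deriv D K X Y Z = D X (K Y Z) - K (D X Y) Z - K Y (D X Z)"

definition tensor_comm ::
  "('m vfield \<Rightarrow> 'm vfield \<Rightarrow> 'm vfield) \<Rightarrow> 'm vfield \<Rightarrow> 'm vfield \<Rightarrow> 'm vfield \<Rightarrow> 'm vfield"
  where "tensor_comm K X Y Z = K X (K Y Z) - K Y (K X Z)"

end

theory Submission
  imports Defs
begin

text \<open>
  The dual connection is \<open>D + K\<close> and the mean connection is \<open>D + (1/2) K\<close>, so all connections in the
  theorem lie on the affine line \<open>D + t K\<close>. Expanding \<open>(D + t K)\<^sub>X (D + t K)\<^sub>Y Z\<close> makes the curvature
  a quadratic polynomial in \<open>t\<close> (\<open>curvature_add_scaleR\<close>): its linear coefficient is the
  antisymmetrised covariant derivative \<open>P = (D\<^sub>X K)(Y, Z) - (D\<^sub>Y K)(X, Z)\<close> plus \<open>K(T(X, Y), Z)\<close>, where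
  \<open>T\<close> is the torsion of \<open>D\<close>, and its quadratic coefficient is \<open>C = [K\<^sub>X, K\<^sub>Y] Z\<close>. As \<open>T = 0\<close>, the
  curvatures at \<open>t = 1/2\<close> and \<open>t = 1\<close> are \<open>R + (1/2) P + (1/4) C\<close> and \<open>R + P + C\<close>, which are the
  formulas that differentiate \<open>K\<close> by \<open>D\<close>, and their consequences.

  The formulas that differentiate \<open>K\<close> by the mean connection follow by moving \<open>P\<close> along the same line
  (\<open>alt_cov_deriv_add_scaleR\<close>). With \<open>W = K(K(X, Y) - K(Y, X), Z)\<close>, the antisymmetrised covariant
  derivative at \<open>t = 1/2\<close> is \<open>P + C - (1/2) W\<close>. The mean connection has torsion
  \<open>(1/2) (K(X, Y) - K(Y, X))\<close>, and so the term with this torsion is exactly what cancels \<open>W\<close>.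

  Both expansions rest on the real bilinearity of \<open>D\<close> and \<open>K\<close> on the space of vector fields, which
  follows from the axioms of a connection because constants are smooth functions that tangent vectors
  annihilate. That \<open>[X, Y]\<close> is a vector field comes from \<open>T = 0\<close>, as \<open>[X, Y] = D\<^sub>X Y - D\<^sub>Y X\<close>.
\<close>

section \<open>The real vector space of vector fields\<close>

lemma Ck_on_cong:
  fixes f h :: "'a::real_normed_vector \<Rightarrow> 'b::real_normed_vector"
  assumes "open S" and "\<And>x. x \<in> S \<Longrightarrow> f x = h x" and "Ck_on k S f"
  shows "Ck_on k S h"
  using assms(2,3)
proof (induction k arbitrary: f h)
  case 0
  then show ?case by (metis Ck_on.simps(1) continuous_on_cong)
next
  case (Suc k)
  have D: "(h has_derivative frechet_derivative f (at x)) (at x)" if "x \<in> S" for x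
    using that Suc.prems \<open>open S\<close>
    by (auto intro: has_derivative_transform_within_open[of f] simp: frechet_derivative_works[symmetric])
  then have eq: "frechet_derivative h (at x) = frechet_derivative f (at x)" if "x \<in> S" for x
    using that by (metis frechet_derivative_at)
  show ?case
    unfolding Ck_on.simps
  proof (intro conjI ballI allI)
    show "h differentiable at x" if "x \<in> S" for x
      using D[OF that] by (rule differentiableI)
    show "Ck_on k S (\<lambda>x. frechet_derivative h (at x) v)" for v
      by (rule Suc.IH[of "\<lambda>x. frechet_derivative f (at x) v"]) (use Suc.prems eq in auto)
  qed
qed

text \<open>
  Differentiation commutes with linear combinations, but only at points of \<open>S\<close>. Openness of \<open>S\<close> makes
  this enough for the higher derivatives.
\<close>

lemma Ck_on_linear_combination:
  fixes f h :: "'a::real_normed_vector \<Rightarrow> 'b::real_normed_vector"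
  assumes "open S" and "Ck_on k S f" and "Ck_on k S h"
  shows "Ck_on k S (\<lambda>x. a *\<^sub>R f x + b *\<^sub>R h x)"
  using assms(2,3)
proof (induction k arbitrary: f h)
  case 0
  then show ?case by (auto intro!: continuous_intros)
next
  case (Suc k)
  have D: "((\<lambda>x. a *\<^sub>R f x + b *\<^sub>R h x) has_derivative
      (\<lambda>v. a *\<^sub>R frechet_derivative f (at x) v + b *\<^sub>R frechet_derivative h (at x) v)) (at x)"
    if "x \<in> S" for x
    using that Suc.prems
    by (auto intro!: has_derivative_add has_derivative_scaleR_right simp: frechet_derivative_works[symmetric])
  have "Ck_on k S (\<lambda>x. frechet_derivative (\<lambda>x. a *\<^sub>R f x + b *\<^sub>R h x) (at x) v)" for v
  proof (rule Ck_on_cong[OF \<open>open S\<close>])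
    show "Ck_on k S (\<lambda>x. a *\<^sub>R frechet_derivative f (at x) v + b *\<^sub>R frechet_derivative h (at x) v)"
      using Suc by auto
    show "a *\<^sub>R frechet_derivative f (at x) v + b *\<^sub>R frechet_derivative h (at x) v
        = frechet_derivative (\<lambda>x. a *\<^sub>R f x + b *\<^sub>R h x) (at x) v" if "x \<in> S" for x
      using fun_cong[OF frechet_derivative_at[OF D[OF that]]] .
  qed
  moreover have "(\<lambda>x. a *\<^sub>R f x + b *\<^sub>R h x) differentiable at x" if "x \<in> S" for x
    using D[OF that] by (rule differentiableI)
  ultimately show ?case by simp
qed

lemma Ck_on_const: "Ck_on k S (\<lambda>x::'a::real_normed_vector. c::'b::real_normed_vector)"
  by (induction k arbitrary: c) auto

lemma smooth_functions_const: "(\<lambda>p. c) \<in> smooth_functions A"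
  by (auto simp: smooth_functions_def smooth_on_def comp_def Ck_on_const)

lemma smooth_functions_linear_combination:
  assumes "smooth_atlas A" and "f \<in> smooth_functions A" and "h \<in> smooth_functions A"
  shows "(\<lambda>p. a * f p + b * h p) \<in> smooth_functions A"
proof -
  have "smooth_on (\<phi> ` U) ((\<lambda>p. a * f p + b * h p) \<circ> inv_into U \<phi>)" if "(U, \<phi>) \<in> A" for U \<phi>
  proof -
    have "open (\<phi> ` U)"
      using assms(1) that by (auto simp: smooth_atlas_def)
    then show ?thesis
      using assms(2,3) that Ck_on_linear_combination[of "\<phi> ` U" _ "f \<circ> inv_into U \<phi>" "h \<circ> inv_into U \<phi>" a b]
      by (fastforce simp: smooth_functions_def smooth_on_def comp_def)
  qed
  then show ?thesis by (auto simp: smooth_functions_def)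
qed

lemma tangent_space_linear_combination:
  assumes "u \<in> tangent_space A p" and "v \<in> tangent_space A p"
  shows "a *\<^sub>R u + b *\<^sub>R v \<in> tangent_space A p"
  using assms by (auto simp: tangent_space_def algebra_simps)

lemma subspace_vector_fields:
  assumes "smooth_atlas A"
  shows "subspace (vector_fields A)"
proof -
  have comb: "a *\<^sub>R X + b *\<^sub>R Y \<in> vector_fields A"
    if "X \<in> vector_fields A" "Y \<in> vector_fields A" for a b X Y
    using that smooth_functions_linear_combination[OF assms, of "vf_apply X _" "vf_apply Y _"]
    by (auto simp: vector_fields_def vf_apply_def intro!: tangent_space_linear_combination)
  have "0 \<in> vector_fields A"
    by (auto simp: vector_fields_def tangent_space_def vf_apply_def zero_fun_def
        intro: smooth_functions_const)
  then show ?thesis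
    using comb[where a = 1 and b = 1] comb[where b = 0] by (auto simp: subspace_def)
qed

text \<open>A derivation at \<open>p\<close> satisfies \<open>v 1 = v (1 \<cdot> 1) = 2 v 1\<close>, hence \<open>v 1 = 0\<close>.\<close>

lemma tangent_space_const:
  assumes "v \<in> tangent_space A p"
  shows "v (\<lambda>q. c) = 0"
proof -
  have "v (\<lambda>q. f q * h q) = f p * v h + h p * v f" and "v (\<lambda>q. a * f q) = a * v f"
    if "f \<in> smooth_functions A" "h \<in> smooth_functions A" for f h a
    using assms that by (simp_all add: tangent_space_def)
  from this(1)[of "\<lambda>q. 1" "\<lambda>q. 1"] this(2)[of "\<lambda>q. 1" "\<lambda>q. 1" c]
  show ?thesis by (simp add: smooth_functions_const)
qed


section \<open>Connections and the difference tensor as bilinear operations\<close>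

text \<open>
  The axioms of a connection constrain it on vector fields only, so bilinearity is relative to a set,
  meant to be a subspace.
\<close>

definition bilinear_on :: "'a::real_vector set \<Rightarrow> ('a \<Rightarrow> 'a \<Rightarrow> 'a) \<Rightarrow> bool" where
  "bilinear_on V B \<longleftrightarrow>
    (\<forall>x\<in>V. \<forall>y\<in>V. B x y \<in> V) \<and>
    (\<forall>x\<in>V. \<forall>y\<in>V. \<forall>z\<in>V. B (x + y) z = B x z + B y z \<and> B z (x + y) = B z x + B z y) \<and>
    (\<forall>c. \<forall>x\<in>V. \<forall>y\<in>V. B (c *\<^sub>R x) y = c *\<^sub>R B x y \<and> B x (c *\<^sub>R y) = c *\<^sub>R B x y)"

lemma bilinear_onD:
  assumes "bilinear_on V B" and "x \<in> V" and "y \<in> V"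
  shows "B x y \<in> V"
    and "B (c *\<^sub>R x) y = c *\<^sub>R B x y"
    and "B x (c *\<^sub>R y) = c *\<^sub>R B x y"
    and "z \<in> V \<Longrightarrow> B (x + z) y = B x y + B z y"
    and "z \<in> V \<Longrightarrow> B x (y + z) = B x y + B x z"
  using assms by (auto simp: bilinear_on_def)

lemma bilinear_on_diff_left:
  assumes "subspace V" and "bilinear_on V B" and "x \<in> V" and "y \<in> V" and "z \<in> V"
  shows "B (x - z) y = B x y - B z y"
  using bilinear_onD(4)[OF assms(2) subspace_diff[OF assms(1,3,5)] assms(4,5)] by simp

lemma bilinear_on_diff:
  assumes "subspace V" and "bilinear_on V B" and "bilinear_on V B'"
  shows "bilinear_on V (\<lambda>x y. B x y - B' x y)"
  using assms(2,3) subspace_diff[OF assms(1)]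
  by (auto simp: bilinear_on_def scaleR_diff_right)

lemma affine_connection_bilinear_on:
  assumes "affine_connection A D"
  shows "bilinear_on (vector_fields A) D"
proof -
  have fmult_const: "fmult (\<lambda>p. c) X = c *\<^sub>R X" for c and X :: "'a vfield"
    by (auto simp: fmult_def fun_eq_iff)
  have left: "D (c *\<^sub>R X) Y = c *\<^sub>R D X Y"
    if "X \<in> vector_fields A" "Y \<in> vector_fields A" for c X Y
  proof -
    have "D (fmult (\<lambda>p. c) X) Y = fmult (\<lambda>p. c) (D X Y)"
      using assms that smooth_functions_const[of c A] unfolding affine_connection_def by blast
    then show ?thesis by (simp add: fmult_const)
  qed
  have right: "D X (c *\<^sub>R Y) = c *\<^sub>R D X Y"
    if "X \<in> vector_fields A" "Y \<in> vector_fields A" for c X Y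
  proof -
    have "X p (\<lambda>q. c) = 0" for p
      using that(1) by (auto simp: vector_fields_def intro: tangent_space_const)
    then have "fmult (vf_apply X (\<lambda>p. c)) Y = 0"
      by (auto simp: fmult_def vf_apply_def fun_eq_iff)
    moreover have "D X (fmult (\<lambda>p. c) Y) = fmult (vf_apply X (\<lambda>p. c)) Y + fmult (\<lambda>p. c) (D X Y)"
      using assms that smooth_functions_const[of c A] unfolding affine_connection_def by blast
    ultimately show ?thesis by (simp add: fmult_const)
  qed
  show ?thesis
    using assms left right by (simp add: bilinear_on_def affine_connection_def)
qed


section \<open>Curvature along a line of connections\<close>

text \<open>
  The products of \<open>D\<close> and \<open>K\<close> in the linear coefficient are those of the two covariant derivatives,
  except that the latter also contain \<open>- K(D\<^sub>X Y - D\<^sub>Y X, Z)\<close> where the curvature has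
  \<open>- K([X, Y], Z)\<close>. The torsion is the difference of the two arguments.
\<close>

lemma curvature_add_scaleR:
  fixes D K :: "'m connection"
  assumes "subspace V" and "bilinear_on V D" and "bilinear_on V K"
    and "X \<in> V" and "Y \<in> V" and "Z \<in> V" and "lie_bracket X Y \<in> V"
  shows "curvature (\<lambda>X Y. D X Y + t *\<^sub>R K X Y) X Y Z =
    curvature D X Y Z + t *\<^sub>R (cov_deriv D K X Y Z - cov_deriv D K Y X Z + K (torsion D X Y) Z)
      + (t * t) *\<^sub>R tensor_comm K X Y Z"
proof -
  note closed = assms bilinear_onD(1)[OF assms(2)] bilinear_onD(1)[OF assms(3)]
    subspace_scale[OF assms(1)] subspace_diff[OF assms(1)]
  have twice: "(D U (D W Z + t *\<^sub>R K W Z)) + t *\<^sub>R K U (D W Z + t *\<^sub>R K W Z) =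
      D U (D W Z) + t *\<^sub>R (D U (K W Z) + K U (D W Z)) + (t * t) *\<^sub>R K U (K W Z)"
    if "U \<in> V" "W \<in> V" for U W
    using that closed
    by (simp add: bilinear_onD[OF assms(2)] bilinear_onD[OF assms(3)] scaleR_add_right)
  have K_torsion: "K (torsion D X Y) Z = K (D X Y) Z - K (D Y X) Z - K (lie_bracket X Y) Z"
    using closed unfolding torsion_def
    by (simp add: bilinear_on_diff_left[OF assms(1,3)])
  show ?thesis
    using closed
    by (simp add: curvature_def cov_deriv_def tensor_comm_def twice K_torsion algebra_simps)
qed

text \<open>
  Replacing \<open>D\<^sub>X\<close> by \<open>D\<^sub>X + t K\<^sub>X\<close> changes \<open>(D\<^sub>X K)(Y, Z)\<close> by \<open>t ([K\<^sub>X, K\<^sub>Y] Z - K(K(X, Y), Z))\<close>. The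
  commutator is already antisymmetric in \<open>X\<close> and \<open>Y\<close>, so antisymmetrising doubles it.
\<close>

lemma alt_cov_deriv_add_scaleR:
  fixes D K :: "'m connection" and t :: real
  assumes "subspace V" and "bilinear_on V D" and "bilinear_on V K"
    and "X \<in> V" and "Y \<in> V" and "Z \<in> V"
  defines "E \<equiv> \<lambda>X Y. D X Y + t *\<^sub>R K X Y"
  shows "cov_deriv E K X Y Z - cov_deriv E K Y X Z =
    cov_deriv D K X Y Z - cov_deriv D K Y X Z
      + t *\<^sub>R (2 *\<^sub>R tensor_comm K X Y Z - K (K X Y - K Y X) Z)"
proof -
  note closed = assms(1-6) bilinear_onD(1)[OF assms(2)] bilinear_onD(1)[OF assms(3)]
    subspace_scale[OF assms(1)]
  have one: "cov_deriv E K U W Z =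
      cov_deriv D K U W Z + t *\<^sub>R (tensor_comm K U W Z - K (K U W) Z)"
    if "U \<in> V" "W \<in> V" for U W
    using that closed
    by (simp add: cov_deriv_def tensor_comm_def E_def bilinear_onD[OF assms(3)] algebra_simps)
  have K_diff: "K (K X Y - K Y X) Z = K (K X Y) Z - K (K Y X) Z"
    using closed by (simp add: bilinear_on_diff_left[OF assms(1,3)])
  show ?thesis
    unfolding one[OF assms(4,5)] one[OF assms(5,4)] K_diff
    by (simp add: tensor_comm_def fun_eq_iff algebra_simps)
qed


section \<open>Quasi-statistical manifolds\<close>

theorem theorem5p4:
  fixes A :: "('m::{t2_space, second_countable_topology}, 'b::euclidean_space) chart set"
    and g :: "'m \<Rightarrow> 'm tvec \<Rightarrow> 'm tvec \<Rightarrow> real"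
    and D D' D0 :: "'m connection"
    and K :: "'m vfield \<Rightarrow> 'm vfield \<Rightarrow> 'm vfield"
    and X Y Z :: "'m vfield"
  assumes "quasi_statistical_manifold A g D"
    and "dual_connection A g D D'"
    and "D0 = mean_connection D D'"
    and "K = difference_tensor D D'"
    and "X \<in> vector_fields A" and "Y \<in> vector_fields A" and "Z \<in> vector_fields A"
  shows
    "(curvature D X Y Z =
        curvature D0 X Y Z
        - (1/2) *\<^sub>R (cov_deriv D0 K X Y Z - cov_deriv D0 K Y X Z - (1/2) *\<^sub>R tensor_comm K X Y Z)
        - (1/2) *\<^sub>R K (torsion D0 X Y) Z
      \<and> curvature D X Y Z =
        curvature D0 X Y Z
        - (1/2) *\<^sub>R (cov_deriv D K X Y Z - cov_deriv D K Y X Z + (1/2) *\<^sub>R tensor_comm K X Y Z))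
     \<and>
     (curvature D' X Y Z =
        curvature D0 X Y Z
        + (1/2) *\<^sub>R (cov_deriv D0 K X Y Z - cov_deriv D0 K Y X Z + (1/2) *\<^sub>R tensor_comm K X Y Z)
        + (1/2) *\<^sub>R K (torsion D0 X Y) Z
      \<and> curvature D' X Y Z =
        curvature D0 X Y Z
        + (1/2) *\<^sub>R (cov_deriv D K X Y Z - cov_deriv D K Y X Z + (3/2) *\<^sub>R tensor_comm K X Y Z))
     \<and>
     (curvature D X Y Z - curvature D' X Y Z =
        - (cov_deriv D0 K X Y Z - cov_deriv D0 K Y X Z) - K (torsion D0 X Y) Z
      \<and> curvature D X Y Z - curvature D' X Y Z =
        - (cov_deriv D K X Y Z - cov_deriv D K Y X Z + tensor_comm K X Y Z))
     \<and>
     curvature D X Y Z + curvature D' X Y Z =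
       2 *\<^sub>R curvature D0 X Y Z + (1/2) *\<^sub>R tensor_comm K X Y Z"
proof -
  define V where "V = vector_fields A"
  have D: "affine_connection A D" and D': "affine_connection A D'" and V: "subspace V"
    using assms(1,2) subspace_vector_fields
    by (auto simp: V_def quasi_statistical_manifold_def dual_connection_def)
  have bD: "bilinear_on V D"
    unfolding V_def using D by (rule affine_connection_bilinear_on)
  have bK: "bilinear_on V K"
    unfolding assms(4) difference_tensor_def V_def
    by (rule bilinear_on_diff[OF V[unfolded V_def]])
      (use D D' affine_connection_bilinear_on in auto)
  have XYZ: "X \<in> V" "Y \<in> V" "Z \<in> V"
    using assms(5-7) by (simp_all add: V_def)
  have T: "torsion D X Y = 0"
    using assms(1,5,6) by (simp add: quasi_statistical_manifold_def)
  then have bracket: "lie_bracket X Y = D X Y - D Y X"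
    by (simp add: torsion_def)
  have bracket_V: "lie_bracket X Y \<in> V"
    unfolding bracket using V bD XYZ by (simp add: subspace_diff bilinear_onD)
  have K_zero: "K 0 Z = 0"
    using bilinear_onD(2)[OF bK XYZ(1,3), of 0] by simp
  have D0_line: "D0 = (\<lambda>X Y. D X Y + (1/2) *\<^sub>R K X Y)"
  proof (intro ext)
    fix X Y p f
    show "D0 X Y p f = (D X Y + (1/2) *\<^sub>R K X Y) p f"
      by (simp add: assms(3,4) mean_connection_def difference_tensor_def field_simps)
  qed
  have D'_line: "D' = (\<lambda>X Y. D X Y + 1 *\<^sub>R K X Y)"
    by (simp add: assms(4) difference_tensor_def)

  define R where "R = curvature D X Y Z"
  define P where "P = cov_deriv D K X Y Z - cov_deriv D K Y X Z"
  define C where "C = tensor_comm K X Y Z"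
  define W where "W = K (K X Y - K Y X) Z"
  note curv = curvature_add_scaleR[OF V bD bK XYZ bracket_V, unfolded T K_zero]
  have R0: "curvature D0 X Y Z = R + (1/2) *\<^sub>R P + (1/4) *\<^sub>R C"
    unfolding D0_line curv by (simp add: R_def P_def C_def)
  have R': "curvature D' X Y Z = R + P + C"
    unfolding D'_line curv by (simp add: R_def P_def C_def)
  have P0: "cov_deriv D0 K X Y Z - cov_deriv D0 K Y X Z = P + C - (1/2) *\<^sub>R W"
    unfolding D0_line alt_cov_deriv_add_scaleR[OF V bD bK XYZ]
    by (simp add: P_def C_def W_def scaleR_diff_right)
  have "torsion D0 X Y = (1/2) *\<^sub>R (K X Y - K Y X)"
    by (simp add: torsion_def D0_line bracket algebra_simps)
  then have T0: "K (torsion D0 X Y) Z = (1/2) *\<^sub>R W"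
    using V bK XYZ by (simp add: W_def bilinear_onD subspace_diff)
  have flip: "cov_deriv D K X Y Z - cov_deriv D K Y X Z = P" "tensor_comm K X Y Z = C"
    "curvature D X Y Z = R"
    by (simp_all add: P_def C_def R_def)
  \<comment> \<open>What remains is linear in \<open>R\<close>, \<open>P\<close>, \<open>C\<close>, \<open>W\<close> and can be checked on their real values.\<close>
  show ?thesis
    unfolding flip R0 R' P0 T0
    by (intro conjI ext; simp add: field_simps)
qed

end
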